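(* Let $\{b_{l,\hbar}\}_{l=0}^{m}$ and $\eta>0$ satisfy Assumption 1 (stated in the context), and let $$L_\hbar=\sum_{l=0}^{m}(-\hbar)^l\partial^l\, b_{l,\hbar}(\sqrt{\hbar}\,x)\,\partial^l\quad\text{on }\mathcal{S}.$$ Then there exists $C\in\mathbb{R}$ such that $C I\preceq_{\mathcal{S}}L_\hbar$ for all $0<\hbar<\eta$.
   Context: $\mathcal{S}=\mathcal{S}(\mathbb{R})$ is the complex Schwartz space, a dense subspace of $L^2(\mathbb{R},dx)$ with inner product $\langle u,v\rangle=\int u\bar v\,dx$; $\partial=d/dx$; $\partial^l b\,\partial^l$ means $f\mapsto\partial^l(b\cdot\partial^lf)$; $I$ is the identity. Order: an operator $A$ is symmetric on $\mathcal{S}$ if $\mathcal{S}\subseteq\mathcal{D}(A)$ and $\langle A\psi,\psi\rangle=\langle\psi,A\psi\rangle$ for all $\psi\in\mathcal{S}$. $A\preceq_{\mathcal{S}}B$ means that $A$ and $B$ are both symmetric on $\mathcal{S}$ and $\langle A\psi,\psi\rangle\le\langle B\psi,\psi\rangle$ for all $\psi\in\mathcal{S}$. Assumption 1 (for a family of real polynomials $\{b_{l,\hbar}\}_{l=0}^m$, $\hbar>0$, with $m\in\mathbb{N}_0$, and a number $\eta>0$): (1) for $0\le l\le m$, $b_{l,\hbar}(x)=\sum_{j=0}^{2m_l}\alpha_{l,j}(\hbar)x^j$ where $m_l\in\mathbb{N}_0$ and each $\alpha_{l,j}$ is a real continuous function on $[0,\eta]$; (2) for all $0<\hbar<\eta$,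 $2m_l=\deg(b_{l,\hbar})\le\deg(b_{l-1,\hbar})=2m_{l-1}$ for $1\le l\le m$; (3) $\inf_{x\in\mathbb{R},\,0<\hbar<\eta}b_{m,\hbar}(x)>0$ and $\min_{0\le l\le m}\inf_{0<\hbar<\eta}\alpha_{l,2m_l}(\hbar)>0$. *)

theory Defs
  imports "HOL-Analysis.Analysis" "HOL-Computational_Algebra.Polynomial"
begin

definition partial :: "(real \<Rightarrow> complex) \<Rightarrow> real \<Rightarrow> complex" where
  "partial f = (\<lambda>x. vector_derivative f (at x))"

definition schwartz :: "(real \<Rightarrow> complex) set" where
  "schwartz = {f. (\<forall>l x. (partial ^^ l) f differentiable (at x)) \<and>
                  (\<forall>k l. bounded (range (\<lambda>x. complex_of_real (x ^ k) * (partial ^^ l) f x)))}"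

text \<open>Elements of the Hilbert space are represented by functions; two functions stand for the
  same element iff they agree almost everywhere.\<close>

definition L2 :: "(real \<Rightarrow> complex) set" where
  "L2 = {f \<in> borel_measurable lborel. integrable lborel (\<lambda>x. (norm (f x))\<^sup>2)}"

definition inner_L2 :: "(real \<Rightarrow> complex) \<Rightarrow> (real \<Rightarrow> complex) \<Rightarrow> complex" where
  "inner_L2 u v = (LINT x|lborel. u x * cnj (v x))"

record l2_op =
  op_dom :: "(real \<Rightarrow> complex) set"
  op_app :: "(real \<Rightarrow> complex) \<Rightarrow> (real \<Rightarrow> complex)"

text \<open>A linear operator defined on a subspace of the Hilbert space. The last clause says that it
  is well defined on classes of functions modulo null sets.\<close>

definition l2_operator :: "l2_op \<Rightarrow> bool" where
  "l2_operator A \<longleftrightarrow>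
     op_dom A \<subseteq> L2 \<and> op_app A ` op_dom A \<subseteq> L2 \<and>
     (\<lambda>_. 0) \<in> op_dom A \<and>
     (\<forall>f\<in>op_dom A. \<forall>g\<in>op_dom A. \<forall>a b. (\<lambda>x. a * f x + b * g x) \<in> op_dom A \<and>
        (AE x in lborel. op_app A (\<lambda>x. a * f x + b * g x) x = a * op_app A f x + b * op_app A g x)) \<and>
     (\<forall>f\<in>op_dom A. \<forall>g\<in>op_dom A. (AE x in lborel. f x = g x) \<longrightarrow>
        (AE x in lborel. op_app A f x = op_app A g x))"

definition op_id :: l2_op where
  "op_id = \<lparr>op_dom = L2, op_app = (\<lambda>f. f)\<rparr>"

definition op_scale :: "complex \<Rightarrow> l2_op \<Rightarrow> l2_op" where
  "op_scale c A = \<lparr>op_dom = op_dom A, op_app = (\<lambda>f x. c * op_app A f x)\<rparr>"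

definition symmetric_on_schwartz :: "l2_op \<Rightarrow> bool" where
  "symmetric_on_schwartz A \<longleftrightarrow>
     l2_operator A \<and> schwartz \<subseteq> op_dom A \<and>
     (\<forall>\<psi>\<in>schwartz. inner_L2 (op_app A \<psi>) \<psi> = inner_L2 \<psi> (op_app A \<psi>))"

text \<open>For operators symmetric on the Schwartz space both inner products below are real, so that
  comparing the real parts compares the numbers themselves.\<close>

definition op_le :: "l2_op \<Rightarrow> l2_op \<Rightarrow> bool"  (infix \<open>\<preceq>\<^sub>S\<close> 50) where
  "A \<preceq>\<^sub>S B \<longleftrightarrow>
     symmetric_on_schwartz A \<and> symmetric_on_schwartz B \<and>
     (\<forall>\<psi>\<in>schwartz. Re (inner_L2 (op_app A \<psi>) \<psi>) \<le> Re (inner_L2 (op_app B \<psi>) \<psi>))"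

text \<open>The family is given by \<open>b l h\<close> for \<open>l \<le> m\<close> and \<open>h > 0\<close>; \<open>M l\<close> is half the degree
  and \<open>\<alpha> l j\<close> are the coefficient functions. Infima are taken in the extended reals, since
  \<^const>\<open>Inf\<close> on the reals is unspecified for sets that are not bounded below.\<close>

definition assumption1 :: "nat \<Rightarrow> (nat \<Rightarrow> real \<Rightarrow> real poly) \<Rightarrow> real \<Rightarrow> bool" where
  "assumption1 m b \<eta> \<longleftrightarrow> 0 < \<eta> \<and>
     (\<exists>(M :: nat \<Rightarrow> nat) (\<alpha> :: nat \<Rightarrow> nat \<Rightarrow> real \<Rightarrow> real).
        (\<forall>l\<le>m. (\<forall>j\<le>2 * M l. continuous_on {0..\<eta>} (\<alpha> l j)) \<and>
               (\<forall>h\<in>{0<..<\<eta>}. \<forall>x. poly (b l h) x = (\<Sum>j\<le>2 * M l. \<alpha> l j h * x ^ j))) \<and>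
        (\<forall>h\<in>{0<..<\<eta>}. \<forall>l\<in>{1..m}.
            2 * M l = degree (b l h) \<and> degree (b l h) \<le> degree (b (l - 1) h) \<and>
            degree (b (l - 1) h) = 2 * M (l - 1)) \<and>
        0 < (INF (x, h)\<in>UNIV \<times> {0<..<\<eta>}. ereal (poly (b m h) x)) \<and>
        0 < (MIN l\<in>{0..m}. INF h\<in>{0<..<\<eta>}. ereal (\<alpha> l (2 * M l) h)))"

definition L_op :: "nat \<Rightarrow> (nat \<Rightarrow> real \<Rightarrow> real poly) \<Rightarrow> real \<Rightarrow> l2_op" where
  "L_op m b h = \<lparr>op_dom = schwartz,
     op_app = (\<lambda>f x. \<Sum>l\<le>m. complex_of_real ((- h) ^ l) *
        (partial ^^ l) (\<lambda>y. complex_of_real (poly (b l h) (sqrt h * y)) * (partial ^^ l) f y) x)\<rparr>"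

end

theory Submission
  imports Defs "HOL-Probability.Sinc_Integral"
begin

text \<open>
  Integrating by parts \<open>l\<close> times in the \<open>l\<close>-th summand turns the quadratic form of \<open>L\<^sub>h\<close> into
  \<open>\<langle>L\<^sub>h f, f\<rangle> = \<Sum>\<^sub>l h\<^sup>l \<integral> b\<^sub>l (sqrt h x) |\<partial>\<^sup>l f|\<^sup>2 dx\<close>,
  the sign \<open>(-h)\<^sup>l\<close> being compensated by the \<open>l\<close> sign changes (\<open>inner_L_op\<close>). The form is real, so
  \<open>L\<^sub>h\<close> is symmetric. The polynomials have even degree, coefficients that are bounded uniformly in
  \<open>h\<close> because they are continuous on a compact interval, and leading coefficients bounded away from
  zero; hence all of them are at least \<open>-K\<close> for one constant \<open>K\<close>, while \<open>b\<^sub>m\<close> is at least some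
  \<open>c > 0\<close> (\<open>assumption1_bounds\<close>).

  Write \<open>E l\<close> for \<open>h\<^sup>l\<close> times the squared norm of the \<open>l\<close>-th derivative of \<open>f\<close>. What remains is
  to bound \<open>c E m - K (E 0 + \<dots> + E (m-1))\<close> from below by a multiple of \<open>E 0\<close>, the squared norm of
  \<open>f\<close>, with a factor that depends neither on \<open>f\<close> nor on \<open>h\<close>. The squared norm of \<open>f'\<close> is
  \<open>-\<langle>f, f''\<rangle>\<close>, which gives \<open>E (l+1) \<le> t E (l+2) + E l / t\<close> for all \<open>t > 0\<close>; the powers of \<open>h\<close>
  in the operator are exactly those for which \<open>h\<close> cancels from this inequality. Every sequence with this property allows
  intermediate terms to be absorbed into an arbitrarily small multiple of the top term plus a
  multiple of the bottom term (\<open>interpolating_absorb_sum\<close>), with constants depending only on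
  \<open>c\<close>, \<open>K\<close> and the number of terms. This is the source of the uniformity in \<open>h\<close>.
\<close>

section \<open>Closure properties of the Schwartz space\<close>

lemma partial_eqI: "(\<And>x. (f has_vector_derivative f' x) (at x)) \<Longrightarrow> partial f = f'"
  by (auto simp: partial_def fun_eq_iff vector_derivative_at)

lemma schwartz_bounded:
  assumes "f \<in> schwartz"
  obtains B where "\<And>x. norm (complex_of_real (x ^ k) * (partial ^^ l) f x) \<le> B"
  using assms unfolding schwartz_def bounded_iff by blast

lemma schwartzI:
  assumes "\<And>l x. (partial ^^ l) f differentiable (at x)"
    and "\<And>k l. \<exists>B. \<forall>x. norm (complex_of_real (x ^ k) * (partial ^^ l) f x) \<le> B"
  shows "f \<in> schwartz"
  using assms unfolding schwartz_def bounded_iff by (auto simp del: of_real_power)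

lemma schwartz_partial_funpow:
  assumes "f \<in> schwartz"
  shows "(partial ^^ l) f \<in> schwartz"
  using assms by (auto simp: schwartz_def simp flip: funpow_add o_apply[of "partial ^^ _" "partial ^^ _"])

lemma schwartz_partial: "f \<in> schwartz \<Longrightarrow> partial f \<in> schwartz"
  using schwartz_partial_funpow[of f 1] by simp

lemma schwartz_has_vector_derivative:
  assumes "f \<in> schwartz"
  shows "((partial ^^ l) f has_vector_derivative (partial ^^ Suc l) f x) (at x)"
proof -
  have "(partial ^^ l) f differentiable (at x)"
    using assms unfolding schwartz_def by blast
  then show ?thesis
    by (simp add: partial_def vector_derivative_works)
qed

lemma schwartz_isCont:
  assumes "f \<in> schwartz"
  shows "isCont f x"
  using schwartz_has_vector_derivative[OF assms, of 0 x] has_vector_derivative_continuous by auto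

lemma schwartz_measurable:
  assumes "f \<in> schwartz"
  shows "f \<in> borel_measurable borel"
  by (intro borel_measurable_continuous_onI continuous_at_imp_continuous_on)
     (use schwartz_isCont[OF assms] in auto)

lemma partial_funpow_lincomb:
  assumes "f \<in> schwartz" "g \<in> schwartz"
  shows "(partial ^^ l) (\<lambda>x. a * f x + c * g x) = (\<lambda>x. a * (partial ^^ l) f x + c * (partial ^^ l) g x)"
proof (induction l)
  case (Suc l)
  have "partial (\<lambda>x. a * (partial ^^ l) f x + c * (partial ^^ l) g x) =
        (\<lambda>x. a * (partial ^^ Suc l) f x + c * (partial ^^ Suc l) g x)"
    by (rule partial_eqI)
       (intro has_vector_derivative_add has_vector_derivative_mult_right
          schwartz_has_vector_derivative assms)
  with Suc show ?case by simp
qed simp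

lemma schwartz_lincomb:
  assumes "f \<in> schwartz" "g \<in> schwartz"
  shows "(\<lambda>x. a * f x + c * g x) \<in> schwartz"
proof (rule schwartzI)
  fix l x
  have "((\<lambda>x. a * (partial ^^ l) f x + c * (partial ^^ l) g x) has_vector_derivative
         (a * (partial ^^ Suc l) f x + c * (partial ^^ Suc l) g x)) (at x)"
    by (intro has_vector_derivative_add has_vector_derivative_mult_right
          schwartz_has_vector_derivative assms)
  then show "(partial ^^ l) (\<lambda>x. a * f x + c * g x) differentiable (at x)"
    unfolding partial_funpow_lincomb[OF assms] by (rule differentiableI_vector)
next
  fix k l
  obtain B1 where B1: "\<And>x. norm (complex_of_real (x ^ k) * (partial ^^ l) f x) \<le> B1"
    using schwartz_bounded[OF assms(1)] by blast
  obtain B2 where B2: "\<And>x. norm (complex_of_real (x ^ k) * (partial ^^ l) g x) \<le> B2"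
    using schwartz_bounded[OF assms(2)] by blast
  have "norm (complex_of_real (x ^ k) * (partial ^^ l) (\<lambda>x. a * f x + c * g x) x)
          \<le> norm a * B1 + norm c * B2" for x
  proof -
    have "complex_of_real (x ^ k) * (partial ^^ l) (\<lambda>x. a * f x + c * g x) x
        = a * (complex_of_real (x ^ k) * (partial ^^ l) f x)
        + c * (complex_of_real (x ^ k) * (partial ^^ l) g x)"
      by (simp add: partial_funpow_lincomb[OF assms] algebra_simps)
    also have "norm \<dots> \<le> norm a * norm (complex_of_real (x ^ k) * (partial ^^ l) f x)
        + norm c * norm (complex_of_real (x ^ k) * (partial ^^ l) g x)"
      by (metis norm_mult norm_triangle_ineq)
    also have "\<dots> \<le> norm a * B1 + norm c * B2"
      by (intro add_mono mult_left_mono B1 B2) auto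
    finally show ?thesis .
  qed
  then show "\<exists>B. \<forall>x. norm (complex_of_real (x ^ k) * (partial ^^ l) (\<lambda>x. a * f x + c * g x) x) \<le> B"
    by blast
qed

lemma schwartz_zero: "(\<lambda>_. 0) \<in> schwartz"
proof (rule schwartzI)
  have *: "(partial ^^ l) (\<lambda>_. 0) = (\<lambda>_. 0)" for l
    by (induction l) (auto simp: partial_def)
  show "(partial ^^ l) (\<lambda>_. 0) differentiable (at x)" for l x
    by (simp add: *)
  show "\<exists>B. \<forall>x. norm (complex_of_real (x ^ k) * (partial ^^ l) (\<lambda>_. 0) x) \<le> B" for k l
    by (auto simp: *)
qed

lemma schwartz_sum:
  assumes "finite A" "\<And>i. i \<in> A \<Longrightarrow> f i \<in> schwartz"
  shows "(\<lambda>x. \<Sum>i\<in>A. c i * f i x) \<in> schwartz"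
  using assms
proof (induction A rule: finite_induct)
  case (insert i A)
  then show ?case
    using schwartz_lincomb[of "f i" "\<lambda>x. \<Sum>i\<in>A. c i * f i x" "c i" 1] by simp
qed (simp add: schwartz_zero)

lemma has_vector_derivative_coord_mult:
  assumes "(f has_vector_derivative f') (at x)"
  shows "((\<lambda>x. complex_of_real x * f x) has_vector_derivative (complex_of_real x * f' + f x)) (at x)"
proof -
  have "((\<lambda>x. complex_of_real x) has_vector_derivative 1) (at x)"
    using has_vector_derivative_of_real[OF DERIV_ident] by simp
  from has_vector_derivative_mult[OF this assms] show ?thesis by simp
qed

text \<open>Leibniz' rule: the second and higher derivatives of the factor \<open>x\<close> vanish, so only two
  terms survive. For \<open>l = 0\<close> the truncated index \<open>l - 1\<close> is harmless because its coefficient is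
  zero. Multiplication by general polynomials then needs no product rule of its own, since they
  are built from constants, sums and this case.\<close>

lemma partial_funpow_coord_mult:
  assumes "f \<in> schwartz"
  shows "(partial ^^ l) (\<lambda>x. complex_of_real x * f x) =
         (\<lambda>x. complex_of_real x * (partial ^^ l) f x + of_nat l * (partial ^^ (l - 1)) f x)"
proof (induction l)
  case (Suc l)
  have l: "of_nat l * (partial ^^ Suc (l - 1)) f x = of_nat l * (partial ^^ l) f x" for x
    by (cases l) auto
  have "partial (\<lambda>x. complex_of_real x * (partial ^^ l) f x + of_nat l * (partial ^^ (l - 1)) f x) =
        (\<lambda>x. (complex_of_real x * (partial ^^ Suc l) f x + (partial ^^ l) f x)
             + of_nat l * (partial ^^ Suc (l - 1)) f x)"
    by (rule partial_eqI)
       (intro has_vector_derivative_add has_vector_derivative_mult_right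
          has_vector_derivative_coord_mult schwartz_has_vector_derivative assms)
  also have "\<dots> = (\<lambda>x. complex_of_real x * (partial ^^ Suc l) f x + of_nat (Suc l) * (partial ^^ l) f x)"
    unfolding l by (simp add: algebra_simps)
  finally show ?case using Suc by simp
qed simp

lemma schwartz_coord_mult:
  assumes "f \<in> schwartz"
  shows "(\<lambda>x. complex_of_real x * f x) \<in> schwartz"
proof (rule schwartzI)
  fix l x
  have "((\<lambda>x. complex_of_real x * (partial ^^ l) f x + of_nat l * (partial ^^ (l - 1)) f x)
     has_vector_derivative (complex_of_real x * (partial ^^ Suc l) f x + (partial ^^ l) f x)
             + of_nat l * (partial ^^ Suc (l - 1)) f x) (at x)"
    by (intro has_vector_derivative_add has_vector_derivative_mult_right
          has_vector_derivative_coord_mult schwartz_has_vector_derivative assms)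
  then show "(partial ^^ l) (\<lambda>x. complex_of_real x * f x) differentiable (at x)"
    unfolding partial_funpow_coord_mult[OF assms] by (rule differentiableI_vector)
next
  fix k l
  obtain B1 where B1: "\<And>x. norm (complex_of_real (x ^ Suc k) * (partial ^^ l) f x) \<le> B1"
    using schwartz_bounded[OF assms] by blast
  obtain B2 where B2: "\<And>x. norm (complex_of_real (x ^ k) * (partial ^^ (l - 1)) f x) \<le> B2"
    using schwartz_bounded[OF assms] by blast
  have "norm (complex_of_real (x ^ k) * (partial ^^ l) (\<lambda>x. complex_of_real x * f x) x)
          \<le> B1 + of_nat l * B2" for x
  proof -
    have "complex_of_real (x ^ k) * (partial ^^ l) (\<lambda>x. complex_of_real x * f x) x
        = complex_of_real (x ^ Suc k) * (partial ^^ l) f x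
        + of_nat l * (complex_of_real (x ^ k) * (partial ^^ (l - 1)) f x)"
      by (simp add: partial_funpow_coord_mult[OF assms] algebra_simps)
    also have "norm \<dots> \<le> norm (complex_of_real (x ^ Suc k) * (partial ^^ l) f x)
        + of_nat l * norm (complex_of_real (x ^ k) * (partial ^^ (l - 1)) f x)"
      by (metis norm_mult norm_of_nat norm_triangle_ineq)
    also have "\<dots> \<le> B1 + of_nat l * B2"
      by (intro add_mono mult_left_mono B1 B2) auto
    finally show ?thesis .
  qed
  then show "\<exists>B. \<forall>x. norm (complex_of_real (x ^ k) * (partial ^^ l) (\<lambda>x. complex_of_real x * f x) x) \<le> B"
    by blast
qed

lemma schwartz_poly_mult:
  assumes "f \<in> schwartz"
  shows "(\<lambda>x. complex_of_real (poly p (s * x)) * f x) \<in> schwartz"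
proof (induction p)
  case 0
  then show ?case by (simp add: schwartz_zero)
next
  case (pCons a p)
  from schwartz_lincomb[OF assms schwartz_coord_mult[OF pCons.IH],
      of "complex_of_real a" "complex_of_real s"]
  show ?case by (simp add: algebra_simps)
qed

section \<open>Integration of Schwartz functions\<close>

text \<open>Boundedness of \<open>f\<close> and of \<open>x\<^sup>2 f\<close> together compare \<open>f\<close> with the integrable function
  \<open>1 / (1 + x\<^sup>2)\<close>, which gives both integrability and the vanishing of boundary terms.\<close>

lemma schwartz_decay:
  assumes "f \<in> schwartz"
  obtains B where "0 \<le> B" "\<And>x. norm (f x) \<le> B * inverse (1 + x\<^sup>2)" "\<And>x. norm (f x) \<le> B"
proof -
  obtain B0 where B0: "\<And>x. norm (complex_of_real (x ^ 0) * (partial ^^ 0) f x) \<le> B0"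
    using schwartz_bounded[OF assms] by blast
  obtain B2 where B2: "\<And>x. norm (complex_of_real (x ^ 2) * (partial ^^ 0) f x) \<le> B2"
    using schwartz_bounded[OF assms] by blast
  have nn: "0 \<le> B0" "0 \<le> B2"
    using order_trans[OF norm_ge_zero B0[of 0]] order_trans[OF norm_ge_zero B2[of 0]] by auto
  have "norm (f x) \<le> (B0 + B2) * inverse (1 + x\<^sup>2)" for x
  proof -
    have "norm (f x) * (1 + x\<^sup>2) \<le> B0 + B2"
      using B0[of x] B2[of x] by (simp add: norm_mult norm_power algebra_simps)
    moreover have "0 < 1 + x\<^sup>2"
      by (simp add: add_pos_nonneg)
    ultimately show ?thesis
      by (simp add: field_simps)
  qed
  moreover have "norm (f x) \<le> B0 + B2" for x
    using B0[of x] nn by simp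
  ultimately show ?thesis
    using that[of "B0 + B2"] nn by auto
qed

lemma schwartz_mult_cnj_decay:
  assumes "f \<in> schwartz" "g \<in> schwartz"
  obtains B where "\<And>x. norm (f x * cnj (g x)) \<le> B * inverse (1 + x\<^sup>2)"
proof -
  obtain B1 where B1: "0 \<le> B1" "\<And>x. norm (f x) \<le> B1 * inverse (1 + x\<^sup>2)"
    using schwartz_decay[OF assms(1)] by metis
  obtain B2 where B2: "0 \<le> B2" "\<And>x. norm (g x) \<le> B2"
    using schwartz_decay[OF assms(2)] by metis
  have "norm (f x * cnj (g x)) \<le> B1 * inverse (1 + x\<^sup>2) * B2" for x
    unfolding norm_mult complex_mod_cnj
    by (intro mult_mono B1 B2) (use B1(1) in \<open>auto intro!: mult_nonneg_nonneg\<close>)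
  then show ?thesis
    using that[of "B1 * B2"] by (simp add: mult_ac)
qed

lemma schwartz_integrable_mult_cnj:
  assumes "f \<in> schwartz" "g \<in> schwartz"
  shows "integrable lborel (\<lambda>x. f x * cnj (g x))"
proof -
  obtain B where B: "\<And>x. norm (f x * cnj (g x)) \<le> B * inverse (1 + x\<^sup>2)"
    using schwartz_mult_cnj_decay[OF assms] by blast
  have "integrable lborel (\<lambda>x::real. inverse (1 + x\<^sup>2))"
    using integrable_inverse_1_plus_square by (simp add: set_integrable_def)
  then have i: "integrable lborel (\<lambda>x::real. B * inverse (1 + x\<^sup>2))"
    by simp
  have [measurable]: "f \<in> borel_measurable borel"
    using assms schwartz_measurable by auto
  have [measurable]: "(\<lambda>x. cnj (g x)) \<in> borel_measurable borel"
    by (intro borel_measurable_continuous_onI continuous_intros continuous_at_imp_continuous_on)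
       (use schwartz_isCont[OF assms(2)] in auto)
  show ?thesis
    by (rule Bochner_Integration.integrable_bound[OF i])
       (measurable, intro AE_I2 order_trans[OF B], simp)
qed

lemma schwartz_integrable_norm_square:
  assumes "f \<in> schwartz"
  shows "integrable lborel (\<lambda>x. (norm (f x))\<^sup>2)"
  using integrable_Re[OF schwartz_integrable_mult_cnj[OF assms assms]]
  by (simp flip: complex_norm_square)

lemma schwartz_subset_L2: "schwartz \<subseteq> L2"
  by (auto simp: L2_def schwartz_measurable schwartz_integrable_norm_square)

text \<open>The function \<open>f \<cdot> cnj g\<close> tends to zero at both ends, so its derivative integrates to zero.\<close>

lemma inner_partial:
  assumes "f \<in> schwartz" "g \<in> schwartz"
  shows "inner_L2 (partial f) g = - inner_L2 f (partial g)"
proof -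
  obtain B where B: "\<And>x. norm (f x * cnj (g x)) \<le> B * inverse (1 + x\<^sup>2)"
    using schwartz_mult_cnj_decay[OF assms] by blast
  define F where "F = (\<lambda>x. f x * cnj (g x))"
  define F' where "F' = (\<lambda>x. f x * cnj (partial g x) + partial f x * cnj (g x))"
  have der: "(F has_vector_derivative F' x) (at x)" for x
    unfolding F_def F'_def
    using schwartz_has_vector_derivative[OF assms(1), of 0 x]
      schwartz_has_vector_derivative[OF assms(2), of 0 x]
    by (intro has_vector_derivative_mult has_vector_derivative_cnj) auto
  have cont: "isCont F' x" for x
    unfolding F'_def
    by (intro continuous_intros schwartz_isCont schwartz_partial assms)
  have i1: "integrable lborel (\<lambda>x. f x * cnj (partial g x))"
    and i2: "integrable lborel (\<lambda>x. partial f x * cnj (g x))"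
    by (intro schwartz_integrable_mult_cnj schwartz_partial assms)+
  have int: "integrable lborel F'"
    unfolding F'_def by (intro Bochner_Integration.integrable_add i1 i2)
  have lim_bound: "((\<lambda>x. B * inverse (1 + x\<^sup>2)) \<longlongrightarrow> 0) at_top"
                  "((\<lambda>x. B * inverse (1 + x\<^sup>2)) \<longlongrightarrow> 0) at_bot"
    by real_asymp+
  have lims: "(F \<longlongrightarrow> 0) at_top" "(F \<longlongrightarrow> 0) at_bot"
    by (rule Lim_null_comparison[OF _ lim_bound(1)] Lim_null_comparison[OF _ lim_bound(2)],
        simp add: F_def B del: norm_mult complex_norm_square)+
  have "(LBINT x=-\<infinity>..\<infinity>. F' x) = 0 - 0"
    by (rule interval_integral_FTC_integrable[where F = F])
       (use der cont int lims in \<open>auto simp: ereal_tendsto_simps set_integrable_def\<close>)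
  then have "integral\<^sup>L lborel F' = 0"
    by (simp add: interval_lebesgue_integral_def set_lebesgue_integral_def)
  then have "inner_L2 f (partial g) + inner_L2 (partial f) g = 0"
    unfolding F'_def inner_L2_def using i1 i2 by simp
  then show ?thesis
    by (simp add: eq_neg_iff_add_eq_0 add.commute)
qed

lemma inner_partial_funpow:
  assumes "f \<in> schwartz" "g \<in> schwartz"
  shows "inner_L2 ((partial ^^ l) f) g = (- 1) ^ l * inner_L2 f ((partial ^^ l) g)"
  using assms(2)
proof (induction l arbitrary: g)
  case (Suc l)
  have "inner_L2 ((partial ^^ Suc l) f) g = - inner_L2 ((partial ^^ l) f) (partial g)"
    using inner_partial[OF schwartz_partial_funpow[OF assms(1)] Suc.prems] by simp
  also have "\<dots> = (- 1) ^ Suc l * inner_L2 f ((partial ^^ Suc l) g)"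
    using Suc.IH[OF schwartz_partial[OF Suc.prems]] by (simp add: funpow_swap1)
  finally show ?case .
qed simp

section \<open>Interpolation between derivatives\<close>

text \<open>The left-hand side is \<open>-\<langle>f, f''\<rangle>\<close>; apply the arithmetic-geometric mean inequality under the
  integral.\<close>

lemma interpolation_step:
  assumes "f \<in> schwartz" "0 < t"
  shows "(LINT x|lborel. (norm (partial f x))\<^sup>2)
     \<le> t * (LINT x|lborel. (norm (partial (partial f) x))\<^sup>2) + (LINT x|lborel. (norm (f x))\<^sup>2) / t"
proof -
  have s: "partial f \<in> schwartz" "partial (partial f) \<in> schwartz"
    using assms(1) schwartz_partial by auto
  note i = schwartz_integrable_norm_square[OF assms(1)] schwartz_integrable_norm_square[OF s(2)]
  have i2: "integrable lborel (\<lambda>x. f x * cnj (partial (partial f) x))"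
    by (rule schwartz_integrable_mult_cnj[OF assms(1) s(2)])
  have pointwise: "norm (f x * cnj (partial (partial f) x))
      \<le> t * (norm (partial (partial f) x))\<^sup>2 + (norm (f x))\<^sup>2 / t" for x
  proof -
    define u v where "u = norm (partial (partial f) x)" and "v = norm (f x)"
    \<comment> \<open>The square gives twice the product; the surplus copy is nonnegative and is dropped.\<close>
    have "0 \<le> (t * u - v)\<^sup>2" "0 \<le> t * (u * v)" by (auto simp: u_def v_def assms(2) less_imp_le)
    then have "t * (v * u) \<le> t * (t * u\<^sup>2) + v\<^sup>2"
      by (simp add: power2_eq_square algebra_simps)
    then have "v * u \<le> t * u\<^sup>2 + v\<^sup>2 / t"
      using assms(2) by (simp add: field_simps power2_eq_square)
    then show ?thesis by (simp add: u_def v_def norm_mult)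
  qed
  have "complex_of_real (LINT x|lborel. (norm (partial f x))\<^sup>2) = inner_L2 (partial f) (partial f)"
    unfolding inner_L2_def
    by (simp flip: integral_complex_of_real complex_norm_square)
  also have "\<dots> = - inner_L2 f (partial (partial f))"
    by (rule inner_partial[OF assms(1) s(1)])
  finally have "(LINT x|lborel. (norm (partial f x))\<^sup>2) \<le> norm (inner_L2 f (partial (partial f)))"
    by (metis Re_complex_of_real complex_Re_le_cmod norm_minus_cancel)
  also have "\<dots> \<le> (LINT x|lborel. norm (f x * cnj (partial (partial f) x)))"
    unfolding inner_L2_def by (rule integral_norm_bound)
  also have "\<dots> \<le> (LINT x|lborel. t * (norm (partial (partial f) x))\<^sup>2 + (norm (f x))\<^sup>2 / t)"
    by (intro integral_mono integrable_norm i2 pointwise Bochner_Integration.integrable_add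
          integrable_mult_right integrable_divide i)
  also have "\<dots> = t * (LINT x|lborel. (norm (partial (partial f) x))\<^sup>2)
      + (LINT x|lborel. (norm (f x))\<^sup>2) / t"
    using i by simp
  finally show ?thesis .
qed

text \<open>This isolates the only property of the derivative norms that the absorption argument
  uses. It makes visible that the constants found below serve all functions and all \<open>h\<close> at
  once.\<close>

definition interpolating :: "(nat \<Rightarrow> real) \<Rightarrow> bool" where
  "interpolating E \<longleftrightarrow> (\<forall>l. 0 \<le> E l) \<and> (\<forall>l. \<forall>t>0. E (Suc l) \<le> t * E (Suc (Suc l)) + E l / t)"

text \<open>Induction on \<open>l\<close>: in \<open>E (l+1) \<le> t E (l+2) + E l / t\<close> the last term is, by the induction
  hypothesis with factor \<open>t / 2\<close>, at most half of \<open>E (l+1)\<close> plus a multiple of \<open>E 0\<close>. That half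
  moves to the left, at the cost of doubling \<open>t\<close>.\<close>

lemma interpolating_absorb_one:
  assumes "0 < \<epsilon>"
  shows "\<exists>C. \<forall>E. interpolating E \<longrightarrow> E l \<le> \<epsilon> * E (Suc l) + C * E 0"
  using assms
proof (induction l arbitrary: \<epsilon>)
  case 0
  then show ?case
    by (intro exI[of _ 1]) (auto simp: interpolating_def)
next
  case (Suc l)
  define t where "t = \<epsilon> / 2"
  have t: "0 < t" using Suc.prems by (simp add: t_def)
  from Suc.IH[of "t / 2"] t obtain C
    where C: "\<And>E. interpolating E \<Longrightarrow> E l \<le> t / 2 * E (Suc l) + C * E 0"
    by auto
  have "E (Suc l) \<le> \<epsilon> * E (Suc (Suc l)) + 2 * C / t * E 0" if E: "interpolating E" for E
  proof -
    have "E (Suc l) \<le> t * E (Suc (Suc l)) + E l / t"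
      using E t by (auto simp: interpolating_def)
    also have "E l / t \<le> (t / 2 * E (Suc l) + C * E 0) / t"
      using C[OF E] t by (simp add: divide_right_mono)
    also have "\<dots> = E (Suc l) / 2 + C / t * E 0"
      using t by (simp add: field_simps)
    finally show ?thesis
      by (simp add: t_def)
  qed
  then show ?case by blast
qed

text \<open>When the sum grows by \<open>K E m\<close>, the induction hypothesis leaves \<open>(c + K) E m\<close>, and absorbing
  \<open>E m\<close> with the factor \<open>c / (c + K)\<close> turns this into \<open>c E (m+1)\<close> plus a further multiple of \<open>E 0\<close>.\<close>

lemma interpolating_absorb_sum:
  assumes "0 < c" "0 \<le> K"
  shows "\<exists>C. \<forall>E. interpolating E \<longrightarrow> K * (\<Sum>l<m. E l) \<le> c * E m + C * E 0"
proof (induction m)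
  case 0
  then show ?case
    using assms by (intro exI[of _ 0]) (auto simp: interpolating_def)
next
  case (Suc m)
  then obtain C where C: "\<And>E. interpolating E \<Longrightarrow> K * (\<Sum>l<m. E l) \<le> c * E m + C * E 0"
    by auto
  have pos: "0 < c + K" using assms by simp
  obtain D where D: "\<And>E. interpolating E \<Longrightarrow> E m \<le> c / (c + K) * E (Suc m) + D * E 0"
    using interpolating_absorb_one[of "c / (c + K)" m] pos assms by auto
  have "K * (\<Sum>l<Suc m. E l) \<le> c * E (Suc m) + (C + (c + K) * D) * E 0"
    if E: "interpolating E" for E
  proof -
    have "K * (\<Sum>l<Suc m. E l) \<le> (c + K) * E m + C * E 0"
      using C[OF E] by (simp add: algebra_simps)
    also have "(c + K) * E m \<le> (c + K) * (c / (c + K) * E (Suc m) + D * E 0)"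
      using D[OF E] pos by (intro mult_left_mono) auto
    also have "\<dots> = c * E (Suc m) + (c + K) * D * E 0"
      using pos by (simp add: field_simps)
    finally show ?thesis by (simp add: algebra_simps)
  qed
  then show ?case by blast
qed

definition scaled_energy :: "real \<Rightarrow> (real \<Rightarrow> complex) \<Rightarrow> nat \<Rightarrow> real" where
  "scaled_energy h f l = h ^ l * (LINT x|lborel. (norm ((partial ^^ l) f x))\<^sup>2)"

lemma interpolating_scaled_energy:
  assumes "f \<in> schwartz" "0 < h"
  shows "interpolating (scaled_energy h f)"
  unfolding interpolating_def
proof (intro conjI allI impI)
  show "0 \<le> scaled_energy h f l" for l
    using assms(2) by (simp add: scaled_energy_def)
  fix l and t :: real assume t: "0 < t"
  \<comment> \<open>Using the parameter \<open>h t\<close> instead of \<open>t\<close> is what makes \<open>h\<close> cancel.\<close>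
  define I where "I = (\<lambda>l. LINT x|lborel. (norm ((partial ^^ l) f x))\<^sup>2)"
  have "I (Suc l) \<le> (h * t) * I (Suc (Suc l)) + I l / (h * t)"
    using interpolation_step[OF schwartz_partial_funpow[OF assms(1)], of "h * t" l] t assms(2)
    by (simp add: I_def)
  then have "h ^ Suc l * I (Suc l) \<le> h ^ Suc l * ((h * t) * I (Suc (Suc l)) + I l / (h * t))"
    using assms(2) by (intro mult_left_mono) auto
  also have "\<dots> = t * (h ^ Suc (Suc l) * I (Suc (Suc l))) + (h ^ l * I l) / t"
    using assms(2) t by (simp add: field_simps)
  finally show "scaled_energy h f (Suc l)
      \<le> t * scaled_energy h f (Suc (Suc l)) + scaled_energy h f l / t"
    by (simp add: scaled_energy_def I_def)
qed

section \<open>Lower bounds for the coefficients\<close>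

text \<open>Outside \<open>[-R, R]\<close> the leading term dominates the sum of the others, because all of these
  are at most \<open>A |y|\<close> to the power \<open>2 n - 1\<close> there; inside, the lower terms are bounded and the
  leading one is nonnegative. The bound depends on the coefficients through \<open>\<delta>\<close> and \<open>A\<close> alone,
  which is what makes it uniform over a family. If \<open>n = 0\<close> there are no lower terms and
  \<open>N = 0\<close>.\<close>

lemma even_degree_lower_bound:
  fixes A \<delta> :: real
  assumes "0 < \<delta>" "0 \<le> A"
  shows "\<exists>K\<ge>0. \<forall>a::nat \<Rightarrow> real. \<delta> \<le> a (2 * n) \<longrightarrow> (\<forall>j<2 * n. \<bar>a j\<bar> \<le> A) \<longrightarrow>
           (\<forall>y::real. - K \<le> (\<Sum>j\<le>2 * n. a j * y ^ j))"
proof -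
  define N R where "N = A * (2 * real n)" and "R = max 1 (N / \<delta>)"
  have N: "0 \<le> N" using assms by (simp add: N_def)
  have "- (N * R ^ (2 * n)) \<le> (\<Sum>j\<le>2 * n. a j * y ^ j)"
    if top: "\<delta> \<le> a (2 * n)" and low: "\<And>j. j < 2 * n \<Longrightarrow> \<bar>a j\<bar> \<le> A" for a :: "nat \<Rightarrow> real" and y
  proof -
    \<comment> \<open>Powers of \<open>r\<close> increase with the exponent, unlike those of \<open>|y|\<close> near zero.\<close>
    define r where "r = max 1 \<bar>y\<bar>"
    have r: "1 \<le> r" "\<bar>y\<bar> \<le> r" by (auto simp: r_def)
    have "- (a j * y ^ j) \<le> A * r ^ (2 * n - 1)" if "j < 2 * n" for j
    proof -
      have "- (a j * y ^ j) \<le> \<bar>a j\<bar> * \<bar>y\<bar> ^ j"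
        by (metis abs_ge_minus_self abs_mult power_abs)
      also have "\<dots> \<le> A * r ^ (2 * n - 1)"
      proof (intro mult_mono)
        have "\<bar>y\<bar> ^ j \<le> r ^ j" using r by (intro power_mono) auto
        also have "\<dots> \<le> r ^ (2 * n - 1)" using r that by (intro power_increasing) auto
        finally show "\<bar>y\<bar> ^ j \<le> r ^ (2 * n - 1)" .
      qed (use low[OF that] assms in auto)
      finally show ?thesis .
    qed
    then have "(\<Sum>j<2 * n. - (a j * y ^ j)) \<le> of_nat (card {..<2 * n}) * (A * r ^ (2 * n - 1))"
      by (intro sum_bounded_above) auto
    then have lower: "- (N * r ^ (2 * n - 1)) \<le> (\<Sum>j<2 * n. a j * y ^ j)"
      by (simp add: N_def sum_negf mult_ac)
    have "\<delta> * \<bar>y\<bar> ^ (2 * n) \<le> a (2 * n) * \<bar>y\<bar> ^ (2 * n)"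
      using top by (intro mult_right_mono) auto
    then have leading: "\<delta> * \<bar>y\<bar> ^ (2 * n) \<le> a (2 * n) * y ^ (2 * n)"
      by (simp add: power_mult)
    have split: "(\<Sum>j\<le>2 * n. a j * y ^ j) = (\<Sum>j<2 * n. a j * y ^ j) + a (2 * n) * y ^ (2 * n)"
      by (simp flip: lessThan_Suc_atMost)
    show ?thesis
    proof (cases "\<bar>y\<bar> \<le> R")
      case True
      then have "r \<le> R" by (auto simp: r_def R_def)
      then have "r ^ (2 * n - 1) \<le> R ^ (2 * n - 1)"
        using r by (intro power_mono) auto
      also have "\<dots> \<le> R ^ (2 * n)"
        by (intro power_increasing) (auto simp: R_def)
      finally have "N * r ^ (2 * n - 1) \<le> N * R ^ (2 * n)"
        using N by (intro mult_left_mono) auto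
      moreover have "0 \<le> \<delta> * \<bar>y\<bar> ^ (2 * n)" using assms by simp
      ultimately show ?thesis using lower leading split by linarith
    next
      case False
      then have ry: "r = \<bar>y\<bar>" by (auto simp: r_def R_def)
      have "N / \<delta> \<le> \<bar>y\<bar>" using False by (auto simp: R_def)
      then have "N \<le> \<delta> * \<bar>y\<bar>" using assms by (simp add: field_simps)
      have "N * \<bar>y\<bar> ^ (2 * n - 1) \<le> \<delta> * \<bar>y\<bar> ^ (2 * n)"
      proof (cases n)
        case 0
        then show ?thesis using assms by (simp add: N_def)
      next
        case (Suc k)
        have "N * \<bar>y\<bar> ^ (2 * n - 1) \<le> (\<delta> * \<bar>y\<bar>) * \<bar>y\<bar> ^ (2 * n - 1)"
          using \<open>N \<le> \<delta> * \<bar>y\<bar>\<close> by (intro mult_right_mono) auto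
        also have "\<dots> = \<delta> * \<bar>y\<bar> ^ (2 * n)"
          using Suc by simp
        finally show ?thesis .
      qed
      moreover have "0 \<le> N * R ^ (2 * n)" using N by (simp add: R_def)
      ultimately show ?thesis using lower leading split unfolding ry by linarith
    qed
  qed
  moreover have "0 \<le> N * R ^ (2 * n)" using N by (simp add: R_def)
  ultimately show ?thesis by blast
qed

lemma ereal_pos_INF_lower_bound:
  fixes f :: "'a \<Rightarrow> real"
  assumes "0 < (INF x\<in>S. ereal (f x))"
  obtains c where "0 < c" "\<And>x. x \<in> S \<Longrightarrow> c \<le> f x"
proof -
  obtain c where c: "0 < ereal c" "ereal c < (INF x\<in>S. ereal (f x))"
    using ereal_dense2[OF assms] by auto
  have "c \<le> f x" if "x \<in> S" for x
    using INF_lower[OF that, of "\<lambda>x. ereal (f x)"] c(2) by (metis ereal_less_eq(3) less_imp_le order_trans)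
  with c(1) that show ?thesis by auto
qed

lemma assumption1_bounds:
  assumes "assumption1 m b \<eta>"
  obtains c K where "0 < c" "0 \<le> K"
    "\<And>h x. h \<in> {0<..<\<eta>} \<Longrightarrow> c \<le> poly (b m h) x"
    "\<And>l h x. l \<le> m \<Longrightarrow> h \<in> {0<..<\<eta>} \<Longrightarrow> - K \<le> poly (b l h) x"
proof -
  obtain M \<alpha> where
    cont: "\<And>l j. l \<le> m \<Longrightarrow> j \<le> 2 * M l \<Longrightarrow> continuous_on {0..\<eta>} (\<alpha> l j)" and
    poly: "\<And>l h x. l \<le> m \<Longrightarrow> h \<in> {0<..<\<eta>} \<Longrightarrow> poly (b l h) x = (\<Sum>j\<le>2 * M l. \<alpha> l j h * x ^ j)" and
    top: "0 < (INF (x, h)\<in>UNIV \<times> {0<..<\<eta>}. ereal (poly (b m h) x))" and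
    lead: "0 < (MIN l\<in>{0..m}. INF h\<in>{0<..<\<eta>}. ereal (\<alpha> l (2 * M l) h))"
    using assms unfolding assumption1_def by blast
  have top': "0 < (INF p\<in>UNIV \<times> {0<..<\<eta>}. ereal (poly (b m (snd p)) (fst p)))"
    using top by (simp add: case_prod_unfold)
  obtain c where c: "0 < c" "\<And>p. p \<in> UNIV \<times> {0<..<\<eta>} \<Longrightarrow> c \<le> poly (b m (snd p)) (fst p)"
    using ereal_pos_INF_lower_bound[OF top'] by blast
  have "\<exists>K\<ge>0. \<forall>h\<in>{0<..<\<eta>}. \<forall>x. - K \<le> poly (b l h) x" if l: "l \<le> m" for l
  proof -
    have "0 < (INF h\<in>{0<..<\<eta>}. ereal (\<alpha> l (2 * M l) h))"
      using lead l by (subst (asm) Min_gr_iff) auto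
    then obtain \<delta> where \<delta>: "0 < \<delta>" "\<And>h. h \<in> {0<..<\<eta>} \<Longrightarrow> \<delta> \<le> \<alpha> l (2 * M l) h"
      using ereal_pos_INF_lower_bound by blast
    have "bounded (\<alpha> l j ` {0..\<eta>})" if "j \<le> 2 * M l" for j
      by (intro compact_imp_bounded compact_continuous_image cont l that) auto
    then have "bounded (\<Union>j\<in>{..2 * M l}. \<alpha> l j ` {0..\<eta>})"
      by (intro bounded_UN) auto
    then obtain A where A: "0 < A" "\<And>j h. j \<le> 2 * M l \<Longrightarrow> h \<in> {0..\<eta>} \<Longrightarrow> \<bar>\<alpha> l j h\<bar> \<le> A"
      unfolding bounded_pos by auto
    obtain K where "0 \<le> K" and K: "\<And>a y. \<delta> \<le> a (2 * M l) \<Longrightarrow> (\<And>j. j < 2 * M l \<Longrightarrow> \<bar>a j\<bar> \<le> A)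
        \<Longrightarrow> - K \<le> (\<Sum>j\<le>2 * M l. a j * y ^ j)"
      using even_degree_lower_bound[OF \<delta>(1), of A "M l"] A(1) by auto
    have "- K \<le> poly (b l h) x" if h: "h \<in> {0<..<\<eta>}" for h x
      unfolding poly[OF l h] using h by (intro K \<delta>(2) A(2)) auto
    with \<open>0 \<le> K\<close> show ?thesis by blast
  qed
  then obtain K where K: "\<And>l. l \<le> m \<Longrightarrow> 0 \<le> K l"
    "\<And>l h x. l \<le> m \<Longrightarrow> h \<in> {0<..<\<eta>} \<Longrightarrow> - K l \<le> poly (b l h) x"
    by metis
  have "- (\<Sum>l\<le>m. K l) \<le> poly (b l h) x" if "l \<le> m" "h \<in> {0<..<\<eta>}" for l h x
    using K(2)[OF that, of x] member_le_sum[of l "{..m}" K] K(1) that(1) by auto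
  moreover have "0 \<le> (\<Sum>l\<le>m. K l)"
    using K(1) by (intro sum_nonneg) auto
  ultimately show ?thesis
    using that[of c "\<Sum>l\<le>m. K l"] c by auto
qed

section \<open>The operators\<close>

lemma L2_lincomb:
  assumes "f \<in> L2" "g \<in> L2"
  shows "(\<lambda>x. a * f x + c * g x) \<in> L2"
proof -
  have [measurable]: "f \<in> borel_measurable borel" "g \<in> borel_measurable borel"
    and i: "integrable lborel (\<lambda>x. (norm (f x))\<^sup>2)" "integrable lborel (\<lambda>x. (norm (g x))\<^sup>2)"
    using assms by (auto simp: L2_def)
  have bound: "(norm (a * f x + c * g x))\<^sup>2
      \<le> 2 * (norm a)\<^sup>2 * (norm (f x))\<^sup>2 + 2 * (norm c)\<^sup>2 * (norm (g x))\<^sup>2" for x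
  proof -
    have "(norm (a * f x + c * g x))\<^sup>2 \<le> (norm (a * f x) + norm (c * g x))\<^sup>2"
      by (intro power_mono norm_triangle_ineq) auto
    also have "\<dots> \<le> 2 * (norm (a * f x))\<^sup>2 + 2 * (norm (c * g x))\<^sup>2"
      using zero_le_power2[of "norm (a * f x) - norm (c * g x)"]
      by (simp add: power2_eq_square algebra_simps)
    finally show ?thesis by (simp add: norm_mult power_mult_distrib)
  qed
  have "integrable lborel (\<lambda>x. 2 * (norm a)\<^sup>2 * (norm (f x))\<^sup>2 + 2 * (norm c)\<^sup>2 * (norm (g x))\<^sup>2)"
    using i by auto
  then have "integrable lborel (\<lambda>x. (norm (a * f x + c * g x))\<^sup>2)"
  proof (rule Bochner_Integration.integrable_bound)
    show "(\<lambda>x. (norm (a * f x + c * g x))\<^sup>2) \<in> borel_measurable lborel"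
      by measurable
    show "AE x in lborel. norm ((norm (a * f x + c * g x))\<^sup>2)
        \<le> norm (2 * (norm a)\<^sup>2 * (norm (f x))\<^sup>2 + 2 * (norm c)\<^sup>2 * (norm (g x))\<^sup>2)"
      using bound by (intro AE_I2) (simp add: abs_le_iff)
  qed
  then show ?thesis by (simp add: L2_def)
qed

lemma symmetric_scale_id: "symmetric_on_schwartz (op_scale (complex_of_real C) op_id)"
proof -
  have "(\<lambda>x. complex_of_real C * f x) \<in> L2" if "f \<in> L2" for f
    using L2_lincomb[OF that that, of "complex_of_real C" 0] by simp
  moreover have "(\<lambda>_. 0) \<in> L2" by (simp add: L2_def)
  ultimately have "l2_operator (op_scale (complex_of_real C) op_id)"
    by (auto simp: l2_operator_def op_scale_def op_id_def L2_lincomb algebra_simps)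
  then show ?thesis
    using schwartz_subset_L2
    by (simp add: symmetric_on_schwartz_def op_scale_def op_id_def inner_L2_def mult_ac)
qed

text \<open>Continuous functions that differ somewhere differ on a nonempty open set, which is not null.
  Hence differential operators on the Schwartz space are well defined modulo null sets.\<close>

lemma schwartz_AE_eq_imp_eq:
  assumes "f \<in> schwartz" "g \<in> schwartz" and AE: "AE x in lborel. f x = g x"
  shows "f = g"
proof -
  have cont: "continuous_on UNIV f" "continuous_on UNIV g"
    using assms schwartz_isCont by (auto intro: continuous_at_imp_continuous_on)
  have "open {x. f x \<noteq> g x}"
    by (intro open_Collect_neq cont)
  moreover have "{x. f x \<noteq> g x} \<in> null_sets lborel"
    using AE_iff_null_sets[of "{x. f x \<noteq> g x}" lborel] AE open_Collect_neq[OF cont] by auto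
  then have "negligible {x. f x \<noteq> g x}"
    by (simp add: negligible_iff_null_sets null_sets_completionI)
  ultimately have "{x. f x \<noteq> g x} = {}"
    using open_not_negligible by blast
  then show ?thesis by auto
qed

lemma L_op_schwartz:
  assumes "f \<in> schwartz"
  shows "op_app (L_op m b h) f \<in> schwartz"
  unfolding L_op_def
  by (simp, intro schwartz_sum schwartz_partial_funpow schwartz_poly_mult assms) simp

lemma L_op_lincomb:
  assumes "f \<in> schwartz" "g \<in> schwartz"
  shows "op_app (L_op m b h) (\<lambda>x. a * f x + c * g x) x
       = a * op_app (L_op m b h) f x + c * op_app (L_op m b h) g x"
proof -
  define P where "P = (\<lambda>l f y. complex_of_real (poly (b l h) (sqrt h * y)) * (partial ^^ l) f y)"
  have P: "P l (\<lambda>x. a * f x + c * g x) = (\<lambda>x. a * P l f x + c * P l g x)" for l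
    by (simp add: P_def partial_funpow_lincomb[OF assms] algebra_simps)
  have "P l f \<in> schwartz" "P l g \<in> schwartz" for l
    unfolding P_def by (intro schwartz_poly_mult schwartz_partial_funpow assms)+
  then have "(partial ^^ l) (P l (\<lambda>x. a * f x + c * g x)) x
      = a * (partial ^^ l) (P l f) x + c * (partial ^^ l) (P l g) x" for l
    unfolding P by (subst partial_funpow_lincomb) auto
  moreover have "op_app (L_op m b h) f x
      = (\<Sum>l\<le>m. complex_of_real ((- h) ^ l) * (partial ^^ l) (P l f) x)" for f
    by (simp add: L_op_def P_def)
  ultimately show ?thesis
    by (simp add: sum_distrib_left sum.distrib algebra_simps)
qed

lemma l2_operator_L_op: "l2_operator (L_op m b h)"
proof -
  have dom: "op_dom (L_op m b h) = schwartz" by (simp add: L_op_def)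
  have AE_eq: "AE x in lborel. op_app (L_op m b h) f x = op_app (L_op m b h) g x"
    if "f \<in> schwartz" "g \<in> schwartz" "AE x in lborel. f x = g x" for f g
    using schwartz_AE_eq_imp_eq[OF that] by simp
  show ?thesis
    unfolding l2_operator_def dom
    using schwartz_subset_L2 L_op_schwartz schwartz_zero schwartz_lincomb
    by (auto simp: L_op_lincomb AE_eq)
qed

lemma inner_L_op:
  assumes f: "f \<in> schwartz"
  shows "inner_L2 (op_app (L_op m b h) f) f =
    complex_of_real (\<Sum>l\<le>m. h ^ l *
      (LINT x|lborel. poly (b l h) (sqrt h * x) * (norm ((partial ^^ l) f x))\<^sup>2))"
proof -
  define P where "P = (\<lambda>l y. complex_of_real (poly (b l h) (sqrt h * y)) * (partial ^^ l) f y)"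
  have P: "P l \<in> schwartz" for l
    unfolding P_def by (intro schwartz_poly_mult schwartz_partial_funpow f)
  have summand: "inner_L2 ((partial ^^ l) (P l)) f = (- 1) ^ l * complex_of_real
      (LINT x|lborel. poly (b l h) (sqrt h * x) * (norm ((partial ^^ l) f x))\<^sup>2)" for l
  proof -
    have "inner_L2 (P l) ((partial ^^ l) f) = complex_of_real
      (LINT x|lborel. poly (b l h) (sqrt h * x) * (norm ((partial ^^ l) f x))\<^sup>2)"
      unfolding inner_L2_def P_def integral_complex_of_real[symmetric]
      by (simp add: mult.assoc flip: complex_norm_square)
    then show ?thesis
      using inner_partial_funpow[OF P f, of l l] by simp
  qed
  have L_eq: "op_app (L_op m b h) f
      = (\<lambda>x. \<Sum>l\<le>m. complex_of_real ((- h) ^ l) * (partial ^^ l) (P l) x)"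
    by (simp add: L_op_def P_def)
  have "inner_L2 (op_app (L_op m b h) f) f
      = (\<Sum>l\<le>m. complex_of_real ((- h) ^ l) * inner_L2 ((partial ^^ l) (P l)) f)"
    unfolding inner_L2_def L_eq
    by (simp add: sum_distrib_right mult.assoc
        schwartz_integrable_mult_cnj[OF schwartz_partial_funpow[OF P] f])
  also have "\<dots> = (\<Sum>l\<le>m. complex_of_real (h ^ l *
      (LINT x|lborel. poly (b l h) (sqrt h * x) * (norm ((partial ^^ l) f x))\<^sup>2)))"
  proof (intro sum.cong refl)
    fix l
    have "complex_of_real ((- h) ^ l) * (- 1) ^ l = complex_of_real (h ^ l)"
      by (simp flip: power_mult_distrib)
    then show "complex_of_real ((- h) ^ l) * inner_L2 ((partial ^^ l) (P l)) f = complex_of_real (h ^ l *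
        (LINT x|lborel. poly (b l h) (sqrt h * x) * (norm ((partial ^^ l) f x))\<^sup>2))"
      unfolding summand by (simp only: of_real_mult mult.assoc[symmetric])
  qed
  finally show ?thesis by simp
qed

lemma symmetric_L_op: "symmetric_on_schwartz (L_op m b h)"
proof -
  have "inner_L2 (op_app (L_op m b h) f) f = inner_L2 f (op_app (L_op m b h) f)"
    if "f \<in> schwartz" for f
  proof -
    have "inner_L2 f (op_app (L_op m b h) f) = cnj (inner_L2 (op_app (L_op m b h) f) f)"
      unfolding inner_L2_def Bochner_Integration.integral_cnj[symmetric] by (simp add: mult.commute)
    then show ?thesis
      unfolding inner_L_op[OF that] by simp
  qed
  then show ?thesis
    using l2_operator_L_op by (simp add: symmetric_on_schwartz_def L_op_def)
qed

lemma weighted_energy_lower_bound: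
  assumes f: "f \<in> schwartz" and "0 \<le> h" and "\<And>x. c \<le> poly p x"
  shows "c * scaled_energy h f l
    \<le> h ^ l * (LINT x|lborel. poly p (sqrt h * x) * (norm ((partial ^^ l) f x))\<^sup>2)"
proof -
  note s = schwartz_partial_funpow[OF f, of l]
  have "integrable lborel (\<lambda>x. Re (complex_of_real (poly p (sqrt h * x)) * (partial ^^ l) f x
          * cnj ((partial ^^ l) f x)))"
    by (intro integrable_Re schwartz_integrable_mult_cnj schwartz_poly_mult s)
  then have i: "integrable lborel (\<lambda>x. poly p (sqrt h * x) * (norm ((partial ^^ l) f x))\<^sup>2)"
    by (simp add: mult.assoc flip: complex_norm_square)
  have "(LINT x|lborel. c * (norm ((partial ^^ l) f x))\<^sup>2)
      \<le> (LINT x|lborel. poly p (sqrt h * x) * (norm ((partial ^^ l) f x))\<^sup>2)"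
    by (intro integral_mono i integrable_mult_right schwartz_integrable_norm_square s
          mult_right_mono assms) auto
  then have "h ^ l * (c * (LINT x|lborel. (norm ((partial ^^ l) f x))\<^sup>2))
      \<le> h ^ l * (LINT x|lborel. poly p (sqrt h * x) * (norm ((partial ^^ l) f x))\<^sup>2)"
    using \<open>0 \<le> h\<close> by (intro mult_left_mono) auto
  then show ?thesis by (simp add: scaled_energy_def mult_ac)
qed

theorem corollary1p19:
  fixes m :: nat and b :: "nat \<Rightarrow> real \<Rightarrow> real poly" and \<eta> :: real
  assumes "assumption1 m b \<eta>"
  shows "\<exists>C::real. \<forall>h. 0 < h \<and> h < \<eta> \<longrightarrow> op_scale (complex_of_real C) op_id \<preceq>\<^sub>S L_op m b h"
proof -
  obtain c K where c: "0 < c" and K: "0 \<le> K"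
    and top: "\<And>h x. h \<in> {0<..<\<eta>} \<Longrightarrow> c \<le> poly (b m h) x"
    and low: "\<And>l h x. l \<le> m \<Longrightarrow> h \<in> {0<..<\<eta>} \<Longrightarrow> - K \<le> poly (b l h) x"
    using assumption1_bounds[OF assms] by blast
  obtain C where C: "\<And>E. interpolating E \<Longrightarrow> K * (\<Sum>l<m. E l) \<le> c * E m + C * E 0"
    using interpolating_absorb_sum[OF c K] by blast
  have "op_scale (complex_of_real (- C)) op_id \<preceq>\<^sub>S L_op m b h" if h: "0 < h" "h < \<eta>" for h
    unfolding op_le_def
  proof (intro conjI ballI symmetric_scale_id symmetric_L_op)
    fix f assume f: "f \<in> schwartz"
    define E where "E = scaled_energy h f"
    define Q where "Q = (\<lambda>l. h ^ l *
      (LINT x|lborel. poly (b l h) (sqrt h * x) * (norm ((partial ^^ l) f x))\<^sup>2))"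
    have "inner_L2 (op_app (op_scale (complex_of_real (- C)) op_id) f) f
        = complex_of_real (- C) * inner_L2 f f"
      by (simp add: op_scale_def op_id_def inner_L2_def mult.assoc)
    also have "inner_L2 f f = complex_of_real (E 0)"
      unfolding inner_L2_def E_def scaled_energy_def
      by (simp flip: integral_complex_of_real complex_norm_square)
    finally have "Re (inner_L2 (op_app (op_scale (complex_of_real (- C)) op_id) f) f) = - C * E 0"
      by simp
    also have "\<dots> \<le> c * E m - K * (\<Sum>l<m. E l)"
      using C[OF interpolating_scaled_energy[OF f h(1)]] by (simp add: E_def)
    also have "\<dots> = (\<Sum>l<m. - K * E l) + c * E m"
      by (simp add: sum_distrib_left sum_negf)
    also have "\<dots> \<le> (\<Sum>l<m. Q l) + Q m"
      unfolding Q_def E_def using h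
      by (intro add_mono sum_mono weighted_energy_lower_bound f top low) auto
    also have "\<dots> = Re (inner_L2 (op_app (L_op m b h) f) f)"
      unfolding inner_L_op[OF f] Q_def by (simp flip: lessThan_Suc_atMost)
    finally show "Re (inner_L2 (op_app (op_scale (complex_of_real (- C)) op_id) f) f)
        \<le> Re (inner_L2 (op_app (L_op m b h) f) f)" .
  qed
  then show ?thesis by blast
qed

end
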